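(* Let $\Omega \subseteq \mathbb{C}^n$ be a bounded domain with $C^2$ boundary. If $P \in \partial\Omega$ is a point of strong pseudoconcavity, then $P$ cannot be a boundary orbit accumulation point for the automorphism group action; that is, there do not exist a point $X \in \Omega$ and automorphisms $\varphi_j$ of $\Omega$ ($j = 1, 2, \dots$) with $\varphi_j(X) \to P$ as $j \to \infty$.
   Context: A domain in $\mathbb{C}^n$ is a connected open set. A domain with $C^2$ boundary is written $\Omega = \{\rho < 0\}$ with $\rho$ a $C^2$ function and $\nabla\rho \neq 0$ on $\partial\Omega$. A boundary point $P$ is a point of strong pseudoconcavity if the Levi form of $\rho$ at $P$ is negative definite on the complex tangent space to $\partial\Omega$ at $P$. An automorphism of $\Omega$ is a biholomorphic mapping of $\Omega$ onto itself.
   Formalization: The result is stated for n ≥ 2: for n = 1 the complex tangent space is zero, so every boundary point is vacuously a point of strong pseudoconcavity, and the unit disc is a counterexample. *)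

theory Defs
  imports "HOL-Analysis.Analysis"
begin

text \<open>
  Complex n-space is \<open>complex ^ 'n\<close> with \<open>n = CARD('n)\<close>. As a \<open>euclidean_space\<close> it carries the
  real structure (real inner product, real Frechet derivatives); complex scalar multiplication
  is \<open>(*s)\<close>.
\<close>

definition C2_function :: "('a::real_normed_vector \<Rightarrow> real) \<Rightarrow> bool" where
  "C2_function f \<longleftrightarrow>
     (\<exists>(f' :: 'a \<Rightarrow> 'a \<Rightarrow>\<^sub>L real) (f'' :: 'a \<Rightarrow> 'a \<Rightarrow>\<^sub>L 'a \<Rightarrow>\<^sub>L real).
        (\<forall>x. (f has_derivative blinfun_apply (f' x)) (at x)) \<and>
        (\<forall>x. (f' has_derivative blinfun_apply (f'' x)) (at x)) \<and>
        continuous_on UNIV f'')"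

definition C2_defining_function :: "(complex ^ 'n \<Rightarrow> real) \<Rightarrow> (complex ^ 'n) set \<Rightarrow> bool" where
  "C2_defining_function \<rho> \<Omega> \<longleftrightarrow>
     C2_function \<rho> \<and> \<Omega> = {z. \<rho> z < 0} \<and>
     (\<forall>p\<in>frontier \<Omega>. \<exists>g. GDERIV \<rho> p :> g \<and> g \<noteq> 0)"

definition Cn_domain :: "(complex ^ 'n) set \<Rightarrow> bool" where
  "Cn_domain \<Omega> \<longleftrightarrow> open \<Omega> \<and> connected \<Omega>"

text \<open>
  With \<open>z\<^sub>j = x\<^sub>j + \<i> y\<^sub>j\<close>: \<open>\<partial>/\<partial>z\<^sub>j = (\<partial>/\<partial>x\<^sub>j - \<i> \<partial>/\<partial>y\<^sub>j) / 2\<close> and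
  \<open>\<partial>/\<partial>z\<^sub>j\<close>-bar \<open>= (\<partial>/\<partial>x\<^sub>j + \<i> \<partial>/\<partial>y\<^sub>j) / 2\<close>. The real directions \<open>x\<^sub>j\<close> and \<open>y\<^sub>j\<close> are
  \<open>axis j 1\<close> and \<open>axis j \<i>\<close>.
\<close>

definition d_dz :: "'n \<Rightarrow> (complex ^ 'n \<Rightarrow> complex) \<Rightarrow> complex ^ 'n \<Rightarrow> complex" where
  "d_dz j f p =
     (frechet_derivative f (at p) (axis j 1) - \<i> * frechet_derivative f (at p) (axis j \<i>)) / 2"

definition d_dzbar :: "'n \<Rightarrow> (complex ^ 'n \<Rightarrow> complex) \<Rightarrow> complex ^ 'n \<Rightarrow> complex" where
  "d_dzbar j f p =
     (frechet_derivative f (at p) (axis j 1) + \<i> * frechet_derivative f (at p) (axis j \<i>)) / 2"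

definition complex_tangent_space ::
    "(complex ^ 'n \<Rightarrow> real) \<Rightarrow> complex ^ 'n \<Rightarrow> (complex ^ 'n) set" where
  "complex_tangent_space \<rho> p =
     {w. (\<Sum>j\<in>UNIV. d_dz j (\<lambda>z. complex_of_real (\<rho> z)) p * w $ j) = 0}"

definition levi_form ::
    "(complex ^ 'n \<Rightarrow> real) \<Rightarrow> complex ^ 'n \<Rightarrow> complex ^ 'n \<Rightarrow> complex" where
  "levi_form \<rho> p w =
     (\<Sum>j\<in>UNIV. \<Sum>k\<in>UNIV.
        d_dz j (d_dzbar k (\<lambda>z. complex_of_real (\<rho> z))) p * w $ j * cnj (w $ k))"

text \<open>
  For a \<open>C\<^sup>2\<close> function the Levi form is Hermitian, so its value on the diagonal is real and
  taking \<open>Re\<close> only changes the type. When \<open>CARD('n) = 1\<close> the complex tangent space at a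
  boundary point is trivial, and the condition holds vacuously at every boundary point.
\<close>

definition strongly_pseudoconcave_at ::
    "(complex ^ 'n \<Rightarrow> real) \<Rightarrow> complex ^ 'n \<Rightarrow> bool" where
  "strongly_pseudoconcave_at \<rho> p \<longleftrightarrow>
     (\<forall>w\<in>complex_tangent_space \<rho> p. w \<noteq> 0 \<longrightarrow> Re (levi_form \<rho> p w) < 0)"

text \<open>Holomorphic maps of several variables: Frechet differentiable with complex-linear derivative.\<close>

definition holomorphic_map_on ::
    "(complex ^ 'n \<Rightarrow> complex ^ 'm) \<Rightarrow> (complex ^ 'n) set \<Rightarrow> bool" where
  "holomorphic_map_on f S \<longleftrightarrow>
     (\<forall>z\<in>S. \<exists>f'. (f has_derivative f') (at z) \<and> (\<forall>c v. f' (c *s v) = c *s f' v))"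

definition automorphism ::
    "(complex ^ 'n) set \<Rightarrow> (complex ^ 'n \<Rightarrow> complex ^ 'n) \<Rightarrow> bool" where
  "automorphism \<Omega> \<phi> \<longleftrightarrow>
     bij_betw \<phi> \<Omega> \<Omega> \<and> holomorphic_map_on \<phi> \<Omega> \<and> holomorphic_map_on (inv_into \<Omega> \<phi>) \<Omega>"

definition boundary_orbit_accumulation_point ::
    "(complex ^ 'n) set \<Rightarrow> complex ^ 'n \<Rightarrow> bool" where
  "boundary_orbit_accumulation_point \<Omega> p \<longleftrightarrow>
     p \<in> frontier \<Omega> \<and>
     (\<exists>x\<in>\<Omega>. \<exists>\<phi> :: nat \<Rightarrow> complex ^ 'n \<Rightarrow> complex ^ 'n.
        (\<forall>j. automorphism \<Omega> (\<phi> j)) \<and> (\<lambda>j. \<phi> j x) \<longlonglongrightarrow> p)"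

end

theory Submission
  imports Defs "HOL-Complex_Analysis.Conformal_Mappings"
begin

text \<open>
  The proof is a quantitative form of the Kontinuitaetssatz. Negativity of the Levi form in a
  complex tangent direction \<open>w\<close> at \<open>P\<close> yields a quadratic holomorphic disc
  \<open>\<zeta> \<mapsto> P + \<zeta> w + \<zeta>\<^sup>2 u\<close> along which \<open>\<rho> \<le> - c \<bar>\<zeta>\<bar>\<^sup>2\<close>: it touches the boundary only in its
  centre. The choice is stable. Through every boundary point \<open>b\<close> near \<open>P\<close> there is such a disc, with the
  same \<open>c\<close>, the same radius and the same \<open>u\<close> (lemma \<open>pseudoconcave_discs_uniform\<close>). Pushing this disc by
  \<open>t \<nu>\<close>, where \<open>\<nu>\<close> points into \<open>\<Omega>\<close>, moves it into \<open>\<Omega>\<close>, and its edge keeps a distance \<open>\<eta>\<close> from the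
  complement of \<open>\<Omega>\<close> that depends neither on \<open>b\<close> nor on \<open>t\<close> (lemma \<open>pseudoconcave_disc_family\<close>).

  Let \<open>\<psi>\<close> be a holomorphic map from \<open>\<Omega>\<close> to itself. For two translates of one disc, with centres \<open>x\<close>
  and \<open>y\<close>, each component of \<open>\<psi> (y + a \<zeta>) - \<psi> (x + a \<zeta>)\<close> is a holomorphic function of \<open>\<zeta>\<close>. On the edge it is
  at most a constant times \<open>\<bar>x - y\<bar>\<close>, by the Schwarz lemma on balls of radius \<open>\<eta>\<close>; by the maximum principle
  the same bound holds at the centre (lemma \<open>holomorphic_map_Lipschitz_disc_centers\<close>). So on the
  part of the line \<open>b + \<real> \<nu>\<close> just inside \<open>\<Omega>\<close>, all such \<open>\<psi>\<close> have a common Lipschitz constant, however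
  close to the boundary.

  Now suppose \<open>\<phi>\<^sub>j X \<longlonglongrightarrow> P\<close>. For large \<open>j\<close> the point \<open>q = \<phi>\<^sub>j X\<close> lies a very short way above a boundary
  point \<open>b = q - s \<nu>\<close>. The inverse \<open>\<psi>\<close> of \<open>\<phi>\<^sub>j\<close> sends \<open>q\<close> to \<open>X\<close>, hence by the Lipschitz estimate sends the
  half-open segment from \<open>q\<close> down to \<open>b\<close> (without \<open>b\<close>) into a fixed closed ball \<open>K\<close> around \<open>X\<close> inside \<open>\<Omega>\<close>. The segment
  therefore lies in the compact set \<open>\<phi>\<^sub>j ` K \<subseteq> \<Omega>\<close>, and so does its end point \<open>b\<close>, which contradicts
  \<open>\<rho> b = 0\<close>.
\<close>

section \<open>Holomorphic maps along complex curves\<close>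

lemma norm_complex_scalar_mult: "norm (a *s x) = norm a * norm x" for a :: complex and x :: "complex ^ 'n"
  unfolding norm_vec_def by (simp add: norm_mult L2_set_right_distrib)

lemma bounded_bilinear_complex_scalar_mult:
  "bounded_bilinear ((*s) :: complex \<Rightarrow> complex ^ 'n \<Rightarrow> complex ^ 'n)"
proof
  fix a b :: complex and x y :: "complex ^ 'n" and r :: real
  show "(a + b) *s x = a *s x + b *s x" by (simp add: vec_eq_iff algebra_simps)
  show "a *s (x + y) = a *s x + a *s y" by (simp add: vec_eq_iff algebra_simps)
  show "(r *\<^sub>R a) *s x = r *\<^sub>R (a *s x)" by (simp add: vec_eq_iff)
  show "a *s (r *\<^sub>R x) = r *\<^sub>R (a *s x)" by (simp add: vec_eq_iff)
  have "norm (a *s x) \<le> norm a * norm x * 1" for a and x :: "complex ^ 'n"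
    by (simp add: norm_complex_scalar_mult)
  then show "\<exists>K. \<forall>a (x :: complex ^ 'n). norm (a *s x) \<le> norm a * norm x * K" by blast
qed

lemmas continuous_on_complex_scalar_mult [continuous_intros] =
  bounded_bilinear.continuous_on [OF bounded_bilinear_complex_scalar_mult]
lemmas has_derivative_complex_scalar_mult [derivative_intros] =
  bounded_bilinear.FDERIV [OF bounded_bilinear_complex_scalar_mult]

lemma holomorphic_on_comp_curve:
  fixes f :: "complex ^ 'n \<Rightarrow> complex ^ 'm"
  assumes "holomorphic_map_on f \<Omega>"
    and "\<And>\<zeta>. \<zeta> \<in> S \<Longrightarrow> A \<zeta> \<in> \<Omega>"
    and "\<And>\<zeta>. \<zeta> \<in> S \<Longrightarrow> (A has_derivative (\<lambda>h. h *s A' \<zeta>)) (at \<zeta>)"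
  shows "(\<lambda>\<zeta>. f (A \<zeta>) $ k) holomorphic_on S"
proof (unfold holomorphic_on_def, intro ballI)
  fix \<zeta> assume \<zeta>: "\<zeta> \<in> S"
  obtain f' where f': "(f has_derivative f') (at (A \<zeta>))"
    and lin: "\<And>c v. f' (c *s v) = c *s f' v"
    using assms \<zeta> unfolding holomorphic_map_on_def by blast
  have "((\<lambda>z. f (A z)) has_derivative (\<lambda>h. f' (h *s A' \<zeta>))) (at \<zeta>)"
    using has_derivative_compose [OF assms(3) [OF \<zeta>] f'] .
  then have "((\<lambda>z. f (A z) $ k) has_derivative (\<lambda>h. f' (h *s A' \<zeta>) $ k)) (at \<zeta>)"
    by (rule bounded_linear.has_derivative [OF bounded_linear_vec_nth])
  then have "((\<lambda>z. f (A z) $ k) has_field_derivative (f' (A' \<zeta>) $ k)) (at \<zeta>)"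
    unfolding has_field_derivative_def lin
    by (rule has_derivative_eq_rhs) (simp add: fun_eq_iff mult.commute)
  then show "(\<lambda>\<zeta>. f (A \<zeta>) $ k) field_differentiable at \<zeta> within S"
    using field_differentiable_at_within field_differentiable_def by blast
qed

text \<open>
  The Schwarz lemma on the complex line through \<open>x\<close> and \<open>y\<close>: the difference of two values of a
  component is at most \<open>2 * M\<close>, so the difference quotient over a disc of radius \<open>\<eta>\<close> is at most \<open>2 * M / \<eta>\<close>.
\<close>

lemma holomorphic_map_Lipschitz_at_center:
  fixes f :: "complex ^ 'n \<Rightarrow> complex ^ 'm"
  assumes hol: "holomorphic_map_on f \<Omega>"
    and bound: "\<And>z. z \<in> \<Omega> \<Longrightarrow> norm (f z) < M"
    and ball: "ball x \<eta> \<subseteq> \<Omega>"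
    and y: "dist x y < \<eta>"
  shows "norm (f y $ k - f x $ k) \<le> 2 * M / \<eta> * dist x y"
proof (cases "x = y")
  case False
  define d where "d = dist x y"
  have d: "d > 0" "d < \<eta>" using False y by (auto simp: d_def)
  then have \<eta>: "\<eta> > 0" by simp
  then have "x \<in> \<Omega>" using ball by auto
  then have M: "M > 0" using bound [of x] norm_ge_zero [of "f x"] by linarith
  define e where "e = (1 / d) *\<^sub>R (y - x)"
  define A where "A = (\<lambda>\<zeta>::complex. x + \<zeta> *s (\<eta> *\<^sub>R e))"
  have ne: "norm e = 1" using d by (simp add: e_def d_def dist_norm norm_minus_commute)
  have normA: "norm (\<zeta> *s (\<eta> *\<^sub>R e)) \<le> norm \<zeta> * \<eta>" for \<zeta>
    using ne \<eta> by (simp add: norm_complex_scalar_mult)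
  have A: "A \<zeta> \<in> \<Omega>" if "\<zeta> \<in> ball 0 1" for \<zeta>
  proof -
    have "norm \<zeta> * \<eta> < \<eta>" using that \<eta> by simp
    then have "A \<zeta> \<in> ball x \<eta>" using normA [of \<zeta>] by (simp add: A_def dist_norm)
    then show ?thesis using ball by blast
  qed
  have dA: "(A has_derivative (\<lambda>h. h *s (\<eta> *\<^sub>R e))) (at \<zeta>)" for \<zeta>
    unfolding A_def by (auto intro!: derivative_eq_intros)
  define g where "g = (\<lambda>\<zeta>. (f (A \<zeta>) $ k - f x $ k) / of_real (2 * M))"
  have "(\<lambda>\<zeta>. f (A \<zeta>) $ k) holomorphic_on ball 0 1"
    by (rule holomorphic_on_comp_curve [OF hol A dA])
  then have g_hol: "g holomorphic_on ball 0 1"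
    unfolding g_def using M by (intro holomorphic_intros) auto
  have g0: "g 0 = 0" by (simp add: g_def A_def)
  have g1: "norm (g \<zeta>) < 1" if "norm \<zeta> < 1" for \<zeta>
  proof -
    have "norm (f (A \<zeta>) $ k - f x $ k) \<le> norm (f (A \<zeta>)) + norm (f x)"
      using norm_triangle_ineq4 Finite_Cartesian_Product.norm_nth_le
      by (meson add_mono order_trans)
    also have "\<dots> < 2 * M" using bound [OF A] bound [OF \<open>x \<in> \<Omega>\<close>] that by fastforce
    finally show ?thesis using M by (simp add: g_def norm_divide norm_mult)
  qed
  have "norm (g (of_real (d / \<eta>))) \<le> norm (of_real (d / \<eta>) :: complex)"
    using Schwarz_Lemma(1) [OF g_hol g0 g1, of "of_real (d / \<eta>)"] d \<eta> by (simp add: norm_divide)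
  moreover have "A (of_real (d / \<eta>)) = y"
    using d \<eta> by (simp add: A_def e_def vec_eq_iff) (simp add: scaleR_conv_of_real)
  ultimately show ?thesis using d \<eta> M
    by (simp add: g_def norm_divide norm_mult field_simps flip: d_def)
qed simp

text \<open>
  The point of the estimate is that the centres \<open>x\<close> and \<open>y\<close> may be arbitrarily close to the
  complement of \<open>\<Omega>\<close>: only the edge of the first disc needs room. The difference of a component of \<open>f\<close> along
  the two discs is holomorphic in the disc parameter, so the estimate carries over from the edge
  to the centres by the maximum principle. Both discs must be translates of each other for the edge
  points to be as close as the centres. The factor \<open>CARD('m)\<close> comes from summing over components.
\<close>

lemma holomorphic_map_Lipschitz_disc_centers:
  fixes f :: "complex ^ 'n \<Rightarrow> complex ^ 'm"
  assumes hol: "holomorphic_map_on f \<Omega>"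
    and bound: "\<And>z. z \<in> \<Omega> \<Longrightarrow> norm (f z) < M"
    and x: "\<And>\<zeta>. norm \<zeta> \<le> 1 \<Longrightarrow> x + \<zeta> *s w + \<zeta>\<^sup>2 *s u \<in> \<Omega>"
    and y: "\<And>\<zeta>. norm \<zeta> \<le> 1 \<Longrightarrow> y + \<zeta> *s w + \<zeta>\<^sup>2 *s u \<in> \<Omega>"
    and edge: "\<And>\<zeta>. norm \<zeta> = 1 \<Longrightarrow> ball (x + \<zeta> *s w + \<zeta>\<^sup>2 *s u) \<eta> \<subseteq> \<Omega>"
    and d: "dist x y < \<eta>"
  shows "norm (f y - f x) \<le> real CARD('m) * (2 * M / \<eta> * dist x y)"
proof -
  have "norm ((f y - f x) $ k) \<le> 2 * M / \<eta> * dist x y" for k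
  proof -
    define g where "g = (\<lambda>p \<zeta>. f (p + \<zeta> *s w + \<zeta>\<^sup>2 *s u) $ k)"
    have g: "g p holomorphic_on cball 0 1"
      if "\<And>\<zeta>. norm \<zeta> \<le> 1 \<Longrightarrow> p + \<zeta> *s w + \<zeta>\<^sup>2 *s u \<in> \<Omega>" for p
      unfolding g_def
    proof (rule holomorphic_on_comp_curve [OF hol])
      show "((\<lambda>\<zeta>. p + \<zeta> *s w + \<zeta>\<^sup>2 *s u) has_derivative
              (\<lambda>h. h *s (w + (2 * \<zeta>) *s u))) (at \<zeta>)" for \<zeta>
        by (auto intro!: derivative_eq_intros simp: fun_eq_iff vec_eq_iff algebra_simps)
    qed (use that in auto)
    have G: "(\<lambda>\<zeta>. g y \<zeta> - g x \<zeta>) holomorphic_on cball 0 1"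
      by (intro holomorphic_intros g x y)
    have "norm (g y 0 - g x 0) \<le> 2 * M / \<eta> * dist x y"
    proof (rule maximum_modulus_frontier [where f = "\<lambda>\<zeta>. g y \<zeta> - g x \<zeta>" and S = "cball 0 1"])
      show "(\<lambda>\<zeta>. g y \<zeta> - g x \<zeta>) holomorphic_on interior (cball 0 1)"
        using G holomorphic_on_subset interior_subset by blast
      show "continuous_on (closure (cball 0 1)) (\<lambda>\<zeta>. g y \<zeta> - g x \<zeta>)"
        using G by (simp add: holomorphic_on_imp_continuous_on)
      fix \<zeta> :: complex assume "\<zeta> \<in> frontier (cball 0 1)"
      then have "norm \<zeta> = 1" by simp
      with holomorphic_map_Lipschitz_at_center [OF hol bound edge, of \<zeta> "y + \<zeta> *s w + \<zeta>\<^sup>2 *s u" k] d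
      show "norm (g y \<zeta> - g x \<zeta>) \<le> 2 * M / \<eta> * dist x y"
        by (simp add: g_def dist_norm)
    qed auto
    then show ?thesis by (simp add: g_def)
  qed
  then have "(\<Sum>k\<in>UNIV. norm ((f y - f x) $ k)) \<le> real CARD('m) * (2 * M / \<eta> * dist x y)"
    by (intro sum_bounded_above) auto
  moreover have "norm (f y - f x) \<le> (\<Sum>k\<in>UNIV. norm ((f y - f x) $ k))"
    unfolding norm_vec_def by (rule L2_set_le_sum) simp
  ultimately show ?thesis by (rule order_trans [rotated])
qed

section \<open>Wirtinger derivatives and the Levi form in real terms\<close>

lemma linear_blinfun: "linear (blinfun_apply L)"
  by (rule bounded_linear.linear [OF blinfun.bounded_linear_right])

text \<open>
  The Wirtinger expression \<open>\<partial>\<^sub>x - \<i> \<partial>\<^sub>y\<close> picks out (twice) the complex linear part of a real linear map,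
  and that part may be summed over the coordinates.
\<close>

lemma complex_linear_part_axis_sum:
  fixes L :: "complex ^ 'n \<Rightarrow> complex"
  assumes "linear L"
  shows "(\<Sum>j\<in>UNIV. (L (axis j 1) - \<i> * L (axis j \<i>)) * w $ j) = L w - \<i> * L (\<i> *s w)"
proof -
  have ax: "axis j c = Re c *\<^sub>R axis j 1 + Im c *\<^sub>R axis j \<i>" for j :: 'n and c
    by (auto simp: vec_eq_iff axis_def complex_eq_iff)
  have tm: "(L (axis j 1) - \<i> * L (axis j \<i>)) * c = L (axis j c) - \<i> * L (axis j (\<i> * c))" for j c
  proof -
    have "L (axis j c) = Re c *\<^sub>R L (axis j 1) + Im c *\<^sub>R L (axis j \<i>)" for c
      by (subst ax) (simp add: linear_add [OF assms] linear_scale [OF assms])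
    from this [of c] this [of "\<i> * c"] show ?thesis
      by (simp add: complex_eq_iff algebra_simps)
  qed
  have ex: "v = (\<Sum>j\<in>UNIV. axis j (v $ j))" for v :: "complex ^ 'n"
    by (simp add: vec_eq_iff axis_def if_distrib cong: if_cong)
  have "L v = (\<Sum>j\<in>UNIV. L (axis j (v $ j)))" for v
    by (subst ex) (simp add: linear_sum [OF assms])
  from this [of w] this [of "\<i> *s w"] show ?thesis
    by (simp add: tm sum_subtractf flip: sum_distrib_left)
qed

lemma complex_antilinear_part_axis_sum:
  fixes L :: "complex ^ 'n \<Rightarrow> real"
  assumes "linear L"
  shows "(\<Sum>k\<in>UNIV. (of_real (L (axis k 1)) + \<i> * of_real (L (axis k \<i>))) * cnj (w $ k))
           = of_real (L w) + \<i> * of_real (L (\<i> *s w))"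
proof -
  have "linear (\<lambda>v. complex_of_real (L v))"
    using linear_compose [OF assms, of complex_of_real] bounded_linear_of_real
    by (simp add: o_def bounded_linear.linear)
  from complex_linear_part_axis_sum [OF this, of w, THEN arg_cong [where f = cnj]]
  show ?thesis by simp
qed

text \<open>
  On a complex line, a real linear functional is the real part of a complex linear one. This makes it
  possible to solve the equations for the coefficients of a disc by complex division.
\<close>

lemma real_linear_complex_line:
  fixes L :: "complex ^ 'n \<Rightarrow> real"
  assumes "linear L"
  shows "L (\<zeta> *s v) = Re (\<zeta> * (of_real (L v) - \<i> * of_real (L (\<i> *s v))))"
proof -
  have "\<zeta> *s v = Re \<zeta> *\<^sub>R v + Im \<zeta> *\<^sub>R (\<i> *s v)"
    by (auto simp: vec_eq_iff complex_eq_iff)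
  then show ?thesis using assms by (simp add: linear_add linear_scale)
qed

text \<open>
  On the circle in a complex line, a real quadratic form is a harmonic of degree two plus its mean.
  The harmonic can be cancelled by a quadratic term of a disc; the mean is a multiple of the Levi form.
\<close>

lemma hessian_complex_line:
  fixes H :: "(complex ^ 'n) \<Rightarrow>\<^sub>L (complex ^ 'n) \<Rightarrow>\<^sub>L real"
  assumes "norm \<omega> = 1"
  shows "H (\<omega> *s w) (\<omega> *s w) =
    Re (\<omega>\<^sup>2 * Complex ((H w w - H (\<i> *s w) (\<i> *s w)) / 2) (- (H w (\<i> *s w) + H (\<i> *s w) w) / 2))
    + (H w w + H (\<i> *s w) (\<i> *s w)) / 2"
proof -
  define c s where "c = Re \<omega>" and "s = Im \<omega>"
  have cs: "c\<^sup>2 + s\<^sup>2 = 1" using assms by (simp add: c_def s_def norm_complex_def)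
  have "\<omega> *s w = c *\<^sub>R w + s *\<^sub>R (\<i> *s w)"
    by (auto simp: vec_eq_iff complex_eq_iff c_def s_def)
  then have 1: "H (\<omega> *s w) (\<omega> *s w) = c\<^sup>2 * H w w + c * s * (H w (\<i> *s w) + H (\<i> *s w) w)
      + s\<^sup>2 * H (\<i> *s w) (\<i> *s w)"
    by (simp add: blinfun.bilinear_simps algebra_simps power2_eq_square)
  have 2: "Re (\<omega>\<^sup>2) = c\<^sup>2 - s\<^sup>2" "Im (\<omega>\<^sup>2) = 2 * c * s"
    by (simp_all add: c_def s_def power2_eq_square)
  have 3: "s\<^sup>2 = 1 - c\<^sup>2" using cs by simp
  show ?thesis by (simp add: 1 2 del: Re_power2 Im_power2) (simp add: 3 field_simps)
qed

text \<open>
  The Levi form in a direction \<open>w\<close> averages the real second derivative over the complex line spanned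
  by \<open>w\<close>. Taking real parts removes the mixed terms.
\<close>

lemma levi_form_eq_hessian:
  fixes \<rho> :: "complex ^ 'n \<Rightarrow> real"
  assumes D: "\<And>x. (\<rho> has_derivative blinfun_apply (D x)) (at x)"
    and H: "(D has_derivative blinfun_apply H) (at p)"
  shows "Re (levi_form \<rho> p w) = (H w w + H (\<i> *s w) (\<i> *s w)) / 4"
proof -
  have "((\<lambda>z. complex_of_real (\<rho> z)) has_derivative (\<lambda>h. complex_of_real (D x h))) (at x)" for x
    using D by (auto intro!: derivative_eq_intros)
  then have fD: "frechet_derivative (\<lambda>z. complex_of_real (\<rho> z)) (at x)
      = (\<lambda>h. complex_of_real (D x h))" for x
    using frechet_derivative_at by metis
  have dk: "(d_dzbar k (\<lambda>z. complex_of_real (\<rho> z)) has_derivative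
     (\<lambda>v. (complex_of_real (H v (axis k 1)) + \<i> * complex_of_real (H v (axis k \<i>))) / 2)) (at p)"
    for k :: 'n
    unfolding d_dzbar_def [abs_def] fD
    by (auto intro!: derivative_eq_intros H)
  define E where "E = (\<lambda>k v. (complex_of_real (H v (axis k 1)) + \<i> * complex_of_real (H v (axis k \<i>))) / 2)"
  define G where "G = (\<lambda>v. \<Sum>k\<in>UNIV. E k v * cnj (w $ k))"
  have G: "G v = (of_real (H v w) + \<i> * of_real (H v (\<i> *s w))) / 2" for v
    unfolding G_def E_def using complex_antilinear_part_axis_sum [OF linear_blinfun, of "H v" w]
    by (simp flip: sum_divide_distrib)
  have fE: "frechet_derivative (d_dzbar k (\<lambda>z. complex_of_real (\<rho> z))) (at p) = E k" for k :: 'n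
    using frechet_derivative_at [OF dk] by (simp add: E_def)
  have "linear G"
    by (rule linearI) (simp_all add: G blinfun.bilinear_simps complex_eq_iff field_simps)
  have row: "(\<Sum>k\<in>UNIV. (E k a - \<i> * E k b) / 2 * c * cnj (w $ k)) = (G a - \<i> * G b) * c / 2" for a b c
  proof -
    have "(G a - \<i> * G b) * c / 2 = (\<Sum>k\<in>UNIV. (E k a * cnj (w $ k) - \<i> * (E k b * cnj (w $ k))) * c / 2)"
      by (simp only: G_def sum_distrib_left sum_subtractf sum_distrib_right [symmetric]
          sum_divide_distrib [symmetric])
    also have "\<dots> = (\<Sum>k\<in>UNIV. (E k a - \<i> * E k b) / 2 * c * cnj (w $ k))"
      by (intro sum.cong refl) (simp add: field_simps)
    finally show ?thesis ..
  qed
  have "levi_form \<rho> p w = (\<Sum>j\<in>UNIV. (G (axis j 1) - \<i> * G (axis j \<i>)) * w $ j) / 2"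
    by (simp only: levi_form_def d_dz_def fE row sum_divide_distrib)
  also have "\<dots> = (G w - \<i> * G (\<i> *s w)) / 2"
    using complex_linear_part_axis_sum [OF \<open>linear G\<close>] by simp
  finally show ?thesis by (simp add: G complex_eq_iff)
qed

lemma complex_tangent_space_iff:
  fixes \<rho> :: "complex ^ 'n \<Rightarrow> real"
  assumes "(\<rho> has_derivative blinfun_apply D) (at p)"
  shows "w \<in> complex_tangent_space \<rho> p \<longleftrightarrow> D w = 0 \<and> D (\<i> *s w) = 0"
proof -
  have 1: "((\<lambda>z. complex_of_real (\<rho> z)) has_derivative (\<lambda>h. complex_of_real (D h))) (at p)"
    using assms by (auto intro!: derivative_eq_intros)
  have fD: "frechet_derivative (\<lambda>z. complex_of_real (\<rho> z)) (at p) = (\<lambda>h. complex_of_real (D h))"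
    using frechet_derivative_at [OF 1] by simp
  have "linear (\<lambda>h. complex_of_real (D h))"
    using 1 by (simp add: has_derivative_def bounded_linear.linear)
  from complex_linear_part_axis_sum [OF this, of w]
  have "(\<Sum>j\<in>UNIV. d_dz j (\<lambda>z. complex_of_real (\<rho> z)) p * w $ j)
      = (of_real (D w) - \<i> * of_real (D (\<i> *s w))) / 2"
    by (simp add: d_dz_def fD flip: sum_divide_distrib)
  then have "w \<in> complex_tangent_space \<rho> p \<longleftrightarrow> of_real (D w) - \<i> * of_real (D (\<i> *s w)) = (0 :: complex)"
    unfolding complex_tangent_space_def mem_Collect_eq by (simp only:) simp
  then show ?thesis by (simp add: complex_eq_iff)
qed

text \<open>
  The tangent space is the kernel of one complex linear functional \<open>\<alpha>\<close>; already
  in the plane of two coordinates \<open>j\<close>, \<open>k\<close> it contains \<open>(\<alpha>\<^sub>k, - \<alpha>\<^sub>j)\<close>, or \<open>(1, 0)\<close> if \<open>\<alpha>\<^sub>j = 0\<close>.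
\<close>

lemma complex_tangent_space_nontrivial:
  fixes \<rho> :: "complex ^ 'n \<Rightarrow> real"
  assumes "2 \<le> CARD('n)"
  obtains w where "w \<in> complex_tangent_space \<rho> p" "w \<noteq> 0"
proof -
  obtain j k :: 'n where jk: "j \<noteq> k"
    using assms card_le_Suc0_iff_eq [OF finite, of "UNIV :: 'n set"] by auto
  define \<alpha> where "\<alpha> = (\<lambda>i. d_dz i (\<lambda>z. complex_of_real (\<rho> z)) p)"
  define w where "w = (if \<alpha> j = 0 then axis j 1 else axis j (\<alpha> k) - axis k (\<alpha> j))"
  have "(\<Sum>i\<in>UNIV. \<alpha> i * axis l c $ i) = \<alpha> l * c" for l c
    by (simp add: axis_def if_distrib cong: if_cong)
  then have "(\<Sum>i\<in>UNIV. \<alpha> i * w $ i) = 0"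
    by (cases "\<alpha> j = 0") (simp_all add: w_def right_diff_distrib sum_subtractf)
  moreover have "w \<noteq> 0"
  proof (cases "\<alpha> j = 0")
    case True
    then have "w $ j \<noteq> 0" by (simp add: w_def)
    then show ?thesis by auto
  next
    case False
    then have "w $ k \<noteq> 0" using jk by (simp add: w_def axis_def)
    then show ?thesis by auto
  qed
  ultimately show thesis using that by (simp add: complex_tangent_space_def \<alpha>_def)
qed

section \<open>One-sided estimates along curves\<close>

lemma DERIV_along_curve:
  fixes D :: "'a::real_normed_vector \<Rightarrow> 'a \<Rightarrow>\<^sub>L real"
  assumes D: "\<And>x. (\<rho> has_derivative blinfun_apply (D x)) (at x)"
    and H: "\<And>x. (D has_derivative blinfun_apply (H x)) (at x)"
    and \<gamma>: "(\<gamma> has_vector_derivative v t) (at t)"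
    and v: "(v has_vector_derivative a) (at t)"
  shows "((\<lambda>t. \<rho> (\<gamma> t)) has_real_derivative D (\<gamma> t) (v t)) (at t)"
    and "((\<lambda>t. D (\<gamma> t) (v t)) has_real_derivative H (\<gamma> t) (v t) (v t) + D (\<gamma> t) a) (at t)"
proof -
  have "((\<lambda>t. \<rho> (\<gamma> t)) has_derivative (\<lambda>h. D (\<gamma> t) (h *\<^sub>R v t))) (at t)"
    using has_derivative_compose [OF \<gamma>[unfolded has_vector_derivative_def] D] .
  then show "((\<lambda>t. \<rho> (\<gamma> t)) has_real_derivative D (\<gamma> t) (v t)) (at t)"
    unfolding has_field_derivative_def
    by (rule has_derivative_eq_rhs) (simp add: fun_eq_iff blinfun.bilinear_simps mult.commute)
  have "((\<lambda>t. D (\<gamma> t)) has_derivative (\<lambda>h. H (\<gamma> t) (h *\<^sub>R v t))) (at t)"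
    using has_derivative_compose [OF \<gamma>[unfolded has_vector_derivative_def] H] .
  from blinfun.FDERIV [OF this v[unfolded has_vector_derivative_def]]
  show "((\<lambda>t. D (\<gamma> t) (v t)) has_real_derivative H (\<gamma> t) (v t) (v t) + D (\<gamma> t) a) (at t)"
    unfolding has_field_derivative_def
    by (rule has_derivative_eq_rhs) (simp add: fun_eq_iff blinfun.bilinear_simps algebra_simps)
qed

lemma second_order_upper_bound:
  fixes h h' h'' :: "real \<Rightarrow> real"
  assumes "\<And>s. (h has_real_derivative h' s) (at s)"
    and "\<And>s. (h' has_real_derivative h'' s) (at s)"
    and "h 0 = 0" "h' 0 = 0" "0 \<le> t"
    and "\<And>s. 0 \<le> s \<Longrightarrow> s \<le> t \<Longrightarrow> h'' s \<le> - 2 * c"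
  shows "h t \<le> - c * t\<^sup>2"
proof -
  have h': "h' s \<le> - 2 * c * s" if s: "0 \<le> s" "s \<le> t" for s
  proof -
    have "h' s + 2 * c * s \<le> h' 0 + 2 * c * 0"
    proof (rule DERIV_nonpos_imp_nonincreasing [OF s(1), of "\<lambda>s. h' s + 2 * c * s"])
      fix x assume "0 \<le> x" "x \<le> s"
      then have "h'' x + 2 * c \<le> 0" using assms(6) [of x] s by simp
      moreover have "((\<lambda>s. h' s + 2 * c * s) has_real_derivative h'' x + 2 * c) (at x)"
        using assms(2) by (auto intro!: derivative_eq_intros)
      ultimately show "\<exists>y. ((\<lambda>s. h' s + 2 * c * s) has_real_derivative y) (at x) \<and> y \<le> 0" by blast
    qed
    then show ?thesis using assms(4) by simp
  qed
  have "h t + c * t\<^sup>2 \<le> h 0 + c * 0\<^sup>2"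
  proof (rule DERIV_nonpos_imp_nonincreasing [OF \<open>0 \<le> t\<close>, of "\<lambda>s. h s + c * s\<^sup>2"])
    fix x assume "0 \<le> x" "x \<le> t"
    then have "h' x + 2 * c * x \<le> 0" using h' [of x] by simp
    moreover have "((\<lambda>s. h s + c * s\<^sup>2) has_real_derivative h' x + 2 * c * x) (at x)"
      using assms(1) by (auto intro!: derivative_eq_intros)
    ultimately show "\<exists>y. ((\<lambda>s. h s + c * s\<^sup>2) has_real_derivative y) (at x) \<and> y \<le> 0" by blast
  qed
  then show ?thesis using assms(3) by simp
qed

lemma linear_decrease_along_direction:
  fixes D :: "'a::real_normed_vector \<Rightarrow> 'a \<Rightarrow>\<^sub>L real"
  assumes D: "\<And>x. (\<rho> has_derivative blinfun_apply (D x)) (at x)"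
    and neg: "\<And>x. x \<in> ball P d \<Longrightarrow> D x \<nu> \<le> - m"
    and x: "x \<in> ball P d" "x + t *\<^sub>R \<nu> \<in> ball P d" and t: "0 \<le> t"
  shows "\<rho> (x + t *\<^sub>R \<nu>) \<le> \<rho> x - m * t"
proof -
  have "\<rho> (x + t *\<^sub>R \<nu>) + m * t \<le> \<rho> (x + 0 *\<^sub>R \<nu>) + m * 0"
  proof (rule DERIV_nonpos_imp_nonincreasing [OF t, of "\<lambda>s. \<rho> (x + s *\<^sub>R \<nu>) + m * s"])
    fix s assume s: "0 \<le> s" "s \<le> t"
    have "x + s *\<^sub>R \<nu> \<in> closed_segment x (x + t *\<^sub>R \<nu>)"
      using s by (cases "t = 0") (auto simp: in_segment algebra_simps intro!: exI [of _ "s / t"])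
    then have "x + s *\<^sub>R \<nu> \<in> ball P d"
      using x convex_ball closed_segment_subset by blast
    then have "D (x + s *\<^sub>R \<nu>) \<nu> + m \<le> 0" using neg by fastforce
    moreover have "((\<lambda>s. \<rho> (x + s *\<^sub>R \<nu>)) has_derivative (\<lambda>h. D (x + s *\<^sub>R \<nu>) (h *\<^sub>R \<nu>))) (at s)"
      by (rule has_derivative_compose [OF _ D]) (auto intro!: derivative_eq_intros)
    then have "((\<lambda>s. \<rho> (x + s *\<^sub>R \<nu>)) has_real_derivative D (x + s *\<^sub>R \<nu>) \<nu>) (at s)"
      unfolding has_field_derivative_def
      by (rule has_derivative_eq_rhs) (simp add: fun_eq_iff blinfun.bilinear_simps mult.commute)
    then have "((\<lambda>s. \<rho> (x + s *\<^sub>R \<nu>) + m * s) has_real_derivative D (x + s *\<^sub>R \<nu>) \<nu> + m) (at s)"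
      by (auto intro!: derivative_eq_intros)
    ultimately show "\<exists>y. ((\<lambda>s. \<rho> (x + s *\<^sub>R \<nu>) + m * s) has_real_derivative y) (at s) \<and> y \<le> 0"
      by blast
  qed
  then show ?thesis by simp
qed


section \<open>Discs at a point of strong pseudoconcavity\<close>

text \<open>
  Along a ray \<open>\<zeta> = t \<omega>\<close> with \<open>\<bar>\<omega>\<bar> = 1\<close>, the restriction of \<open>\<rho>\<close> to the disc has vanishing first
  derivative at \<open>t = 0\<close> if the linear coefficient of the disc is a complex tangent vector at \<open>b\<close>. Its
  second derivative at \<open>b = P\<close>, \<open>t = 0\<close> is the sum of a harmonic of degree two in \<open>\<omega>\<close>, which \<open>u\<close> is
  chosen to cancel, and a negative constant. The second derivative is jointly continuous and \<open>\<omega>\<close>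
  ranges over a compact circle, so it stays negative for all \<open>\<omega>\<close> when \<open>b\<close> is near \<open>P\<close> and \<open>t\<close> is
  small. Only the linear coefficient has to depend on \<open>b\<close>, since the first-order term must vanish
  exactly, whereas small errors in the second-order term are harmless.
\<close>

lemma pseudoconcave_discs_uniform:
  fixes \<rho> :: "complex ^ 'n \<Rightarrow> real" and D H P \<nu>
  assumes D: "\<And>x. (\<rho> has_derivative blinfun_apply (D x)) (at x)"
    and H: "\<And>x. (D has_derivative blinfun_apply (H x)) (at x)"
    and contH: "continuous_on UNIV H"
    and \<nu>: "D P \<nu> \<noteq> 0"
    and w: "D P w = 0" "D P (\<i> *s w) = 0"
    and neg: "H P w w + H P (\<i> *s w) (\<i> *s w) < 0"
    and "0 < d"
  obtains c r \<delta> u where "0 < c" "0 < r" "0 < \<delta>"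
    "\<And>b. b \<in> ball P \<delta> \<Longrightarrow> \<exists>w'. \<forall>\<zeta>. norm \<zeta> \<le> r \<longrightarrow>
        b + \<zeta> *s w' + \<zeta>\<^sup>2 *s u \<in> ball P d \<and>
        \<rho> (b + \<zeta> *s w' + \<zeta>\<^sup>2 *s u) \<le> \<rho> b - c * (norm \<zeta>)\<^sup>2"
proof -
  define \<kappa> where "\<kappa> = (\<lambda>b. Complex (D b \<nu>) (- D b (\<i> *s \<nu>)))"
  define \<mu> where "\<mu> = (\<lambda>b. Complex (D b w) (- D b (\<i> *s w)))"
  \<comment> \<open>Subtracting the multiple \<open>\<beta> b\<close> of \<open>\<nu>\<close> makes \<open>w\<close> complex tangent at \<open>b\<close>, by \<open>D\<nu>\<close> and \<open>Dw\<close> below.\<close>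
  define \<beta> where "\<beta> = (\<lambda>b. \<mu> b / \<kappa> b)"
  have contD: "continuous_on UNIV D"
    using H by (meson continuous_at_imp_continuous_on has_derivative_continuous)
  have Dcont: "continuous_on UNIV (\<lambda>b. D b v)" for v
    by (intro blinfun.continuous_on contD continuous_intros)
  have D\<nu>: "D b (\<zeta> *s \<nu>) = Re (\<zeta> * \<kappa> b)" and Dw: "D b (\<zeta> *s w) = Re (\<zeta> * \<mu> b)" for b \<zeta>
    by (simp_all add: real_linear_complex_line [OF linear_blinfun, of _ \<zeta>] \<kappa>_def \<mu>_def)
  have cont\<kappa>: "continuous_on UNIV \<kappa>" and cont\<mu>: "continuous_on UNIV \<mu>"
    unfolding \<kappa>_def \<mu>_def Complex_eq by (intro continuous_intros Dcont)+
  have \<kappa>P: "\<kappa> P \<noteq> 0" using \<nu> by (simp add: \<kappa>_def complex_eq_iff)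
  have \<beta>P: "\<beta> P = 0" using w by (simp add: \<beta>_def \<mu>_def Complex_eq)
  have cont\<beta>: "isCont \<beta> P"
    unfolding \<beta>_def using cont\<kappa> cont\<mu> \<kappa>P
    by (intro continuous_intros) (auto simp: continuous_on_eq_continuous_at)
  \<comment> \<open>The coefficient of the degree-two harmonic from \<open>hessian_complex_line\<close>, which \<open>u\<close> cancels.\<close>
  define q where "q = Complex ((H P w w - H P (\<i> *s w) (\<i> *s w)) / 2)
      (- (H P w (\<i> *s w) + H P (\<i> *s w) w) / 2)"
  define u where "u = (- q / (2 * \<kappa> P)) *s \<nu>"
  define c where "c = - (H P w w + H P (\<i> *s w) (\<i> *s w)) / 8"
  have c: "c > 0" using neg by (simp add: c_def)
  \<comment> \<open>Position, velocity and second derivative of \<open>\<rho>\<close> on the ray \<open>\<omega>\<close>, for a free correction \<open>l\<close>: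
    continuity of \<open>F\<close> then needs no control of \<open>\<beta>\<close>, whose denominator may vanish far from \<open>P\<close>.\<close>
  define X where "X = (\<lambda>b l t \<omega>. b + (of_real t * \<omega>) *s (w - l *s \<nu>) + (of_real t * \<omega>)\<^sup>2 *s u)"
  define V where "V = (\<lambda>l t \<omega>. \<omega> *s (w - l *s \<nu>) + (2 * of_real t * \<omega>\<^sup>2) *s u)"
  define F where "F = (\<lambda>b l t \<omega>. H (X b l t \<omega>) (V l t \<omega>) (V l t \<omega>) + D (X b l t \<omega>) ((2 * \<omega>\<^sup>2) *s u))"
  have F0: "F P 0 0 \<omega> = - 4 * c" if "norm \<omega> = 1" for \<omega>
  proof -
    have "D P ((2 * \<omega>\<^sup>2) *s u) = D P ((2 * \<omega>\<^sup>2 * (- q / (2 * \<kappa> P))) *s \<nu>)"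
      by (simp add: u_def vector_smult_assoc)
    also have "\<dots> = Re (- (\<omega>\<^sup>2 * q))"
      unfolding D\<nu> using \<kappa>P by (simp add: field_simps)
    finally show ?thesis
      using hessian_complex_line [OF that, of "H P" w]
      by (simp add: F_def X_def V_def c_def q_def)
  qed
  define Xf where "Xf = (\<lambda>((b, l, t), \<omega>). X b l t \<omega>)"
  define Vf where "Vf = (\<lambda>((b :: complex ^ 'n, l, t), \<omega>). V l t \<omega>)"
  define Ff where "Ff = (\<lambda>((b, l, t), \<omega>). F b l t \<omega>)"
  have contX: "continuous_on UNIV Xf"
    unfolding Xf_def X_def case_prod_unfold by (intro continuous_intros)
  have contV: "continuous_on UNIV Vf"
    unfolding Vf_def V_def case_prod_unfold by (intro continuous_intros)
  have Ff: "Ff = (\<lambda>z. H (Xf z) (Vf z) (Vf z) + D (Xf z) ((2 * (snd z)\<^sup>2) *s u))"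
    by (simp add: fun_eq_iff Ff_def Xf_def Vf_def F_def)
  have contHX: "continuous_on UNIV (\<lambda>z. H (Xf z))"
    by (rule continuous_on_compose2 [OF contH contX]) simp
  have contDX: "continuous_on UNIV (\<lambda>z. D (Xf z))"
    by (rule continuous_on_compose2 [OF contD contX]) simp
  have contF: "continuous_on UNIV Ff"
    unfolding Ff
    by (rule continuous_on_add [OF blinfun.continuous_on [OF blinfun.continuous_on [OF contHX contV] contV]
          blinfun.continuous_on [OF contDX]]) (intro continuous_intros)
  \<comment> \<open>The second condition keeps the disc in the prescribed ball, without a separate estimate of its size.\<close>
  define W where "W = {z. Ff z < - 2 * c} \<inter> Xf -` ball P d"
  have "open W"
    unfolding W_def
    by (rule open_Int [OF open_Collect_less [OF contF continuous_on_const] open_vimage [OF open_ball contX]])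
  moreover have "{(P, 0, 0)} \<times> sphere 0 1 \<subseteq> W"
    using F0 c \<open>0 < d\<close> by (auto simp: W_def Ff_def Xf_def X_def)
  ultimately have "\<exists>N. (P, 0, 0) \<in> N \<and> open N \<and> N \<times> sphere 0 1 \<subseteq> W"
    by (rule Elementary_Topology.tube_lemma [OF compact_sphere])
  then obtain N where N: "(P, 0, 0) \<in> N" "open N" "N \<times> sphere 0 1 \<subseteq> W" by blast
  obtain A N' where A: "open A" "P \<in> A" and N': "open N'" "(0, 0) \<in> N'" "A \<times> N' \<subseteq> N"
    by (rule open_prod_elim [OF N(2,1)]) blast
  obtain B C where B: "open B" "0 \<in> B" and C: "open C" "0 \<in> C" "B \<times> C \<subseteq> N'"
    by (rule open_prod_elim [OF N'(1,2)]) blast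
  obtain r where r: "r > 0" "cball 0 r \<subseteq> C"
    using C(1,2) open_contains_cball_eq by blast
  have "eventually (\<lambda>b. b \<in> A \<and> \<beta> b \<in> B \<and> \<kappa> b \<noteq> 0) (nhds P)"
  proof (intro eventually_conj)
    show "\<forall>\<^sub>F b in nhds P. b \<in> A" using A by (rule eventually_nhds_in_open)
    show "\<forall>\<^sub>F b in nhds P. \<beta> b \<in> B"
      using cont\<beta> B \<beta>P
      by (metis isCont_def tendsto_at_iff_tendsto_nhds topological_tendstoD)
    have "(\<kappa> \<longlongrightarrow> \<kappa> P) (nhds P)"
      using cont\<kappa> by (simp add: continuous_on_eq_continuous_at isCont_def tendsto_at_iff_tendsto_nhds)
    then show "\<forall>\<^sub>F b in nhds P. \<kappa> b \<noteq> 0"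
      using \<kappa>P by (rule tendsto_imp_eventually_ne)
  qed
  then obtain \<delta> where \<delta>: "\<delta> > 0" "\<And>b. dist b P < \<delta> \<Longrightarrow> b \<in> A \<and> \<beta> b \<in> B \<and> \<kappa> b \<noteq> 0"
    unfolding eventually_nhds_metric by blast
  show thesis
  proof (rule that [OF c r(1) \<delta>(1)])
    fix b assume "b \<in> ball P \<delta>"
    then have b: "b \<in> A" "\<beta> b \<in> B" "\<kappa> b \<noteq> 0" using \<delta>(2) [of b] by (auto simp: dist_commute)
    define w' where "w' = w - \<beta> b *s \<nu>"
    have tangent: "D b (\<omega> *s w') = 0" for \<omega>
    proof -
      have "\<omega> *s w' = \<omega> *s w - (\<omega> * \<beta> b) *s \<nu>"
        by (simp add: w'_def vec_eq_iff algebra_simps)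
      then show ?thesis using b(3) by (simp add: blinfun.bilinear_simps D\<nu> Dw \<beta>_def)
    qed
    have inW: "F b (\<beta> b) t \<omega> < - 2 * c" "X b (\<beta> b) t \<omega> \<in> ball P d"
      if "\<bar>t\<bar> \<le> r" "norm \<omega> = 1" for t \<omega>
    proof -
      have "t \<in> C" using that r(2) by auto
      then have "(b, \<beta> b, t) \<in> N" using b(1,2) N'(3) C(3) by blast
      moreover have "\<omega> \<in> sphere 0 1" using that by simp
      ultimately have "((b, \<beta> b, t), \<omega>) \<in> W" using N(3) by blast
      then show "F b (\<beta> b) t \<omega> < - 2 * c" "X b (\<beta> b) t \<omega> \<in> ball P d" by (auto simp: W_def Ff_def Xf_def)
    qed
    have decr: "\<rho> (X b (\<beta> b) t \<omega>) - \<rho> b \<le> - c * t\<^sup>2" if t: "0 \<le> t" "t \<le> r" and \<omega>: "norm \<omega> = 1" for t \<omega>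
    proof (rule second_order_upper_bound [where t = t])
      have X': "((\<lambda>t. X b (\<beta> b) t \<omega>) has_vector_derivative V (\<beta> b) s \<omega>) (at s)" for s
        unfolding X_def V_def has_vector_derivative_def
        by (auto intro!: derivative_eq_intros simp: fun_eq_iff vec_eq_iff)
          (simp add: scaleR_conv_of_real algebra_simps power2_eq_square)
      have V': "((\<lambda>t. V (\<beta> b) t \<omega>) has_vector_derivative (2 * \<omega>\<^sup>2) *s u) (at s)" for s
        unfolding V_def has_vector_derivative_def
        by (auto intro!: derivative_eq_intros simp: fun_eq_iff vec_eq_iff)
          (simp add: scaleR_conv_of_real algebra_simps)
      show "((\<lambda>t. \<rho> (X b (\<beta> b) t \<omega>) - \<rho> b) has_real_derivative
          D (X b (\<beta> b) s \<omega>) (V (\<beta> b) s \<omega>)) (at s)" for s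
        using DERIV_along_curve(1) [OF D H X' V'] by (auto intro!: derivative_eq_intros)
      show "((\<lambda>s. D (X b (\<beta> b) s \<omega>) (V (\<beta> b) s \<omega>)) has_real_derivative F b (\<beta> b) s \<omega>) (at s)" for s
        using DERIV_along_curve(2) [OF D H X' V'] by (simp add: F_def)
      show "D (X b (\<beta> b) 0 \<omega>) (V (\<beta> b) 0 \<omega>) = 0"
        using tangent by (simp add: X_def V_def w'_def)
      show "F b (\<beta> b) s \<omega> \<le> - 2 * c" if "0 \<le> s" "s \<le> t" for s
        using inW(1) [of s \<omega>] that t \<omega> by simp
    qed (use t in \<open>auto simp: X_def\<close>)
    show "\<exists>w'. \<forall>\<zeta>. norm \<zeta> \<le> r \<longrightarrow> b + \<zeta> *s w' + \<zeta>\<^sup>2 *s u \<in> ball P d \<and>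
        \<rho> (b + \<zeta> *s w' + \<zeta>\<^sup>2 *s u) \<le> \<rho> b - c * (norm \<zeta>)\<^sup>2"
    proof (intro exI [of _ w'] allI impI)
      fix \<zeta> :: complex assume \<zeta>: "norm \<zeta> \<le> r"
      define \<omega> where "\<omega> = (if \<zeta> = 0 then 1 else \<zeta> / of_real (norm \<zeta>))"
      have \<omega>: "norm \<omega> = 1" "of_real (norm \<zeta>) * \<omega> = \<zeta>"
        by (auto simp: \<omega>_def norm_divide)
      then have "X b (\<beta> b) (norm \<zeta>) \<omega> = b + \<zeta> *s w' + \<zeta>\<^sup>2 *s u"
        by (simp add: X_def w'_def)
      then show "b + \<zeta> *s w' + \<zeta>\<^sup>2 *s u \<in> ball P d \<and>
          \<rho> (b + \<zeta> *s w' + \<zeta>\<^sup>2 *s u) \<le> \<rho> b - c * (norm \<zeta>)\<^sup>2"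
        using inW(2) [of "norm \<zeta>" \<omega>] decr [of "norm \<zeta>" \<omega>] \<zeta> \<omega>(1) by simp
    qed
  qed
qed

text \<open>
  The discs through boundary points \<open>b\<close> are rescaled to radius one and pushed along the inner normal
  \<open>\<nu>\<close>, in whose direction \<open>\<rho>\<close> decreases at a rate at least \<open>m\<close>. Along the pushed disc
  \<open>\<rho> \<le> - c (r \<bar>\<zeta>\<bar>)\<^sup>2 - m t\<close>: the second term keeps the centre inside for \<open>t > 0\<close>, and on the edge
  the first term is a bound uniform in \<open>b\<close> and \<open>t\<close>, so uniform continuity of \<open>\<rho>\<close> gives the common \<open>\<eta>\<close>.
  The condition on \<open>P - s *\<^sub>R \<nu>\<close> makes the line in direction \<open>\<nu>\<close> through a point near \<open>P\<close> hit the boundary.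
\<close>

lemma pseudoconcave_disc_family:
  fixes \<rho> :: "complex ^ 'n \<Rightarrow> real" and \<Omega> P
  assumes "2 \<le> CARD('n)" and def: "C2_defining_function \<rho> \<Omega>" and P: "P \<in> frontier \<Omega>"
    and "strongly_pseudoconcave_at \<rho> P"
  obtains \<nu> \<delta> \<eta> where "0 < \<delta>" "0 < \<eta>"
    "\<And>s. 0 < s \<Longrightarrow> s < \<delta> \<Longrightarrow> 0 < \<rho> (P - s *\<^sub>R \<nu>)"
    "\<And>b. b \<in> ball P \<delta> \<Longrightarrow> \<rho> b = 0 \<Longrightarrow> \<exists>w u. \<forall>t. 0 < t \<longrightarrow> t < \<delta> \<longrightarrow>
        (\<forall>\<zeta>. norm \<zeta> \<le> 1 \<longrightarrow> b + t *\<^sub>R \<nu> + \<zeta> *s w + \<zeta>\<^sup>2 *s u \<in> \<Omega>) \<and>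
        (\<forall>\<zeta>. norm \<zeta> = 1 \<longrightarrow> ball (b + t *\<^sub>R \<nu> + \<zeta> *s w + \<zeta>\<^sup>2 *s u) \<eta> \<subseteq> \<Omega>)"
proof -
  obtain D H where D: "\<And>x. (\<rho> has_derivative blinfun_apply (D x)) (at x)"
    and H: "\<And>x. (D has_derivative blinfun_apply (H x)) (at x)"
    and contH: "continuous_on UNIV H"
    using def unfolding C2_defining_function_def C2_function_def by blast
  have \<Omega>: "\<Omega> = {z. \<rho> z < 0}" using def by (simp add: C2_defining_function_def)
  have cont\<rho>: "continuous_on UNIV \<rho>"
    using D by (meson continuous_at_imp_continuous_on has_derivative_continuous)
  have "continuous_on UNIV D"
    using H by (meson continuous_at_imp_continuous_on has_derivative_continuous)
  obtain g where g: "GDERIV \<rho> P :> g" "g \<noteq> 0"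
    using def P by (auto simp: C2_defining_function_def)
  define \<nu> where "\<nu> = - g"
  have "D P = blinfun_inner_left g \<or> True" by simp
  have "blinfun_apply (D P) = (\<lambda>h. h \<bullet> g)"
    using has_derivative_unique [OF D g(1)[unfolded gderiv_def]] .
  then have \<nu>P: "D P \<nu> < 0" using g(2) by (simp add: \<nu>_def)
  define m where "m = - D P \<nu> / 2"
  have m: "m > 0" using \<nu>P by (simp add: m_def)
  have "open {x. D x \<nu> < - m}"
    by (intro open_Collect_less blinfun.continuous_on \<open>continuous_on UNIV D\<close> continuous_on_const)
  moreover have "P \<in> {x. D x \<nu> < - m}" using \<nu>P by (simp add: m_def)
  ultimately obtain d where d: "d > 0" "ball P d \<subseteq> {x. D x \<nu> < - m}"
    using open_contains_ball by blast
  have decr: "\<rho> (x + t *\<^sub>R \<nu>) \<le> \<rho> x - m * t"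
    if "x \<in> ball P d" "x + t *\<^sub>R \<nu> \<in> ball P d" "0 \<le> t" for x t
    using linear_decrease_along_direction [OF D _ that] d(2) by (meson in_mono less_imp_le mem_Collect_eq)
  obtain w where w: "w \<in> complex_tangent_space \<rho> P" "w \<noteq> 0"
    using complex_tangent_space_nontrivial assms(1) by blast
  then have "Re (levi_form \<rho> P w) < 0"
    using assms(4) by (simp add: strongly_pseudoconcave_at_def)
  then have neg: "H P w w + H P (\<i> *s w) (\<i> *s w) < 0"
    using levi_form_eq_hessian [OF D H] by simp
  have wP: "D P w = 0" "D P (\<i> *s w) = 0"
    using w(1) complex_tangent_space_iff [OF D] by blast+
  have "d / 2 > 0" using d by simp
  obtain c r \<delta>1 u where c: "0 < c" and r: "0 < r" and \<delta>1: "0 < \<delta>1"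
    and disc: "\<And>b. b \<in> ball P \<delta>1 \<Longrightarrow> \<exists>w'. \<forall>\<zeta>. norm \<zeta> \<le> r \<longrightarrow>
        b + \<zeta> *s w' + \<zeta>\<^sup>2 *s u \<in> ball P (d / 2) \<and>
        \<rho> (b + \<zeta> *s w' + \<zeta>\<^sup>2 *s u) \<le> \<rho> b - c * (norm \<zeta>)\<^sup>2"
    using pseudoconcave_discs_uniform [OF D H contH less_imp_neq [OF \<nu>P] wP neg \<open>d / 2 > 0\<close>] by metis
  have "uniformly_continuous_on (cball P (d + 1)) \<rho>"
    by (intro compact_uniformly_continuous continuous_on_subset [OF cont\<rho>]) auto
  moreover have "c * r\<^sup>2 > 0" using c r by simp
  ultimately obtain e where e: "e > 0"
    "\<And>x y. x \<in> cball P (d + 1) \<Longrightarrow> y \<in> cball P (d + 1) \<Longrightarrow> dist y x < e \<Longrightarrow> dist (\<rho> y) (\<rho> x) < c * r\<^sup>2"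
    unfolding uniformly_continuous_on_def by metis
  define \<eta> where "\<eta> = min e 1"
  have \<eta>: "\<eta> > 0" using e by (simp add: \<eta>_def)
  define \<delta> where "\<delta> = min \<delta>1 (d / (2 * norm \<nu>))"
  have "norm \<nu> > 0" using g(2) by (simp add: \<nu>_def)
  then have \<delta>: "\<delta> > 0" using \<delta>1 d(1) by (simp add: \<delta>_def)
  have small: "norm (t *\<^sub>R \<nu>) < d / 2" if "0 \<le> t" "t < \<delta>" for t
    using that \<open>norm \<nu> > 0\<close> by (simp add: \<delta>_def field_simps)
  show thesis
  proof (rule that [OF \<delta> \<eta>])
    fix s :: real assume s: "0 < s" "s < \<delta>"
    have "open \<Omega>" unfolding \<Omega> by (intro open_Collect_less cont\<rho> continuous_on_const)
    then have "P \<notin> \<Omega>" using P by (simp add: frontier_def interior_open)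
    moreover have "\<rho> (P - s *\<^sub>R \<nu> + s *\<^sub>R \<nu>) \<le> \<rho> (P - s *\<^sub>R \<nu>) - m * s"
      using small [of s] s d(1) by (intro decr) (auto simp: dist_norm)
    moreover have "m * s > 0" using m s by simp
    ultimately show "0 < \<rho> (P - s *\<^sub>R \<nu>)" by (auto simp: \<Omega>)
  next
    fix b assume b: "b \<in> ball P \<delta>" "\<rho> b = 0"
    then have "b \<in> ball P \<delta>1" by (simp add: \<delta>_def)
    from disc [OF this] obtain w' where w': "\<And>\<zeta>. norm \<zeta> \<le> r \<Longrightarrow>
        b + \<zeta> *s w' + \<zeta>\<^sup>2 *s u \<in> ball P (d / 2) \<and>
        \<rho> (b + \<zeta> *s w' + \<zeta>\<^sup>2 *s u) \<le> - c * (norm \<zeta>)\<^sup>2"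
      using b(2) by auto
    define A where "A = (\<lambda>t \<zeta>. b + t *\<^sub>R \<nu> + \<zeta> *s (of_real r *s w') + \<zeta>\<^sup>2 *s (of_real (r\<^sup>2) *s u))"
    have A: "A t \<zeta> \<in> ball P d" "\<rho> (A t \<zeta>) \<le> - c * (r * norm \<zeta>)\<^sup>2 - m * t"
      if t: "0 < t" "t < \<delta>" and \<zeta>: "norm \<zeta> \<le> 1" for t \<zeta>
    proof -
      define z where "z = b + (r * \<zeta>) *s w' + (r * \<zeta>)\<^sup>2 *s u"
      have "norm (r * \<zeta>) = r * norm \<zeta>" using r by (simp add: norm_mult)
      moreover have "r * norm \<zeta> \<le> r" using r \<zeta> by simp
      ultimately have z: "z \<in> ball P (d / 2)" "\<rho> z \<le> - c * (r * norm \<zeta>)\<^sup>2"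
        using w' [of "r * \<zeta>"] by (simp_all add: z_def)
      have Az: "A t \<zeta> = z + t *\<^sub>R \<nu>"
        by (simp add: A_def z_def vec_eq_iff algebra_simps power_mult_distrib)
      have "dist P (z + t *\<^sub>R \<nu>) \<le> dist P z + norm (t *\<^sub>R \<nu>)"
        by (metis dist_triangle dist_norm add_diff_cancel_left' dist_commute)
      then show "A t \<zeta> \<in> ball P d"
        using z(1) small [of t] t by (simp add: Az)
      moreover have "z \<in> ball P d" using z(1) d(1) by simp
      ultimately show "\<rho> (A t \<zeta>) \<le> - c * (r * norm \<zeta>)\<^sup>2 - m * t"
        using decr [of z t] z(2) t Az by simp
    qed
    show "\<exists>w u. \<forall>t. 0 < t \<longrightarrow> t < \<delta> \<longrightarrow>
        (\<forall>\<zeta>. norm \<zeta> \<le> 1 \<longrightarrow> b + t *\<^sub>R \<nu> + \<zeta> *s w + \<zeta>\<^sup>2 *s u \<in> \<Omega>) \<and>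
        (\<forall>\<zeta>. norm \<zeta> = 1 \<longrightarrow> ball (b + t *\<^sub>R \<nu> + \<zeta> *s w + \<zeta>\<^sup>2 *s u) \<eta> \<subseteq> \<Omega>)"
    proof (intro exI allI impI conjI)
      fix t :: real and \<zeta> :: complex assume t: "0 < t" "t < \<delta>"
      have mt: "m * t > 0" using m t by simp
      {
        assume \<zeta>: "norm \<zeta> \<le> 1"
        have "c * (r * norm \<zeta>)\<^sup>2 \<ge> 0" using c by simp
        then have "\<rho> (A t \<zeta>) < 0" using A(2) [OF t \<zeta>] mt by linarith
        then show "b + t *\<^sub>R \<nu> + \<zeta> *s (of_real r *s w') + \<zeta>\<^sup>2 *s (of_real (r\<^sup>2) *s u) \<in> \<Omega>"
          by (simp add: \<Omega> A_def)
      next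
        assume \<zeta>: "norm \<zeta> = 1"
        have le: "\<rho> (A t \<zeta>) < - (c * r\<^sup>2)" "A t \<zeta> \<in> ball P d" using A [OF t, of \<zeta>] \<zeta> mt by auto
        have "\<rho> y < 0" if y: "y \<in> ball (A t \<zeta>) \<eta>" for y
        proof -
          have "dist P y \<le> dist P (A t \<zeta>) + dist (A t \<zeta>) y" by (rule dist_triangle)
          then have "y \<in> cball P (d + 1)" using y le(2) by (simp add: \<eta>_def)
          then have "dist (\<rho> y) (\<rho> (A t \<zeta>)) < c * r\<^sup>2"
            using e(2) [of "A t \<zeta>" y] le(2) y by (simp add: \<eta>_def dist_commute)
          then show ?thesis using le(1) by (simp add: dist_real_def)
        qed
        then show "ball (b + t *\<^sub>R \<nu> + \<zeta> *s (of_real r *s w') + \<zeta>\<^sup>2 *s (of_real (r\<^sup>2) *s u)) \<eta> \<subseteq> \<Omega>"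
          by (auto simp: \<Omega> A_def)
      }
    qed
  qed
qed

section \<open>Orbits do not accumulate at a point of strong pseudoconcavity\<close>

theorem corollary7:
  fixes \<Omega> :: "(complex ^ 'n) set" and \<rho> :: "complex ^ 'n \<Rightarrow> real" and P :: "complex ^ 'n"
  assumes "2 \<le> CARD('n)"
    and "Cn_domain \<Omega>" and "bounded \<Omega>"
    and "C2_defining_function \<rho> \<Omega>"
    and "P \<in> frontier \<Omega>"
    and "strongly_pseudoconcave_at \<rho> P"
  shows "\<not> boundary_orbit_accumulation_point \<Omega> P"
proof
  assume "boundary_orbit_accumulation_point \<Omega> P"
  then obtain X \<phi> where X: "X \<in> \<Omega>" and aut: "\<And>j :: nat. automorphism \<Omega> (\<phi> j)"
    and lim: "(\<lambda>j. \<phi> j X) \<longlonglongrightarrow> P"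
    unfolding boundary_orbit_accumulation_point_def by blast
  have \<Omega>: "\<Omega> = {z. \<rho> z < 0}" "C2_function \<rho>"
    using assms(4) by (simp_all add: C2_defining_function_def)
  have cont\<rho>: "continuous_on S \<rho>" for S
    using \<Omega>(2) unfolding C2_function_def
    by (meson continuous_at_imp_continuous_on has_derivative_continuous)
  have "open \<Omega>" using assms(2) by (simp add: Cn_domain_def)
  then obtain R where R: "R > 0" "cball X R \<subseteq> \<Omega>"
    using X open_contains_cball by blast
  obtain M where M: "\<And>z. z \<in> \<Omega> \<Longrightarrow> norm z < M"
    using assms(3) bounded_pos_less by metis
  obtain \<nu> \<delta> \<eta> where \<delta>: "0 < \<delta>" and \<eta>: "0 < \<eta>"
    and out: "\<And>s. 0 < s \<Longrightarrow> s < \<delta> \<Longrightarrow> 0 < \<rho> (P - s *\<^sub>R \<nu>)"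
    and discs: "\<And>b. b \<in> ball P \<delta> \<Longrightarrow> \<rho> b = 0 \<Longrightarrow> \<exists>w u. \<forall>t. 0 < t \<longrightarrow> t < \<delta> \<longrightarrow>
        (\<forall>\<zeta>. norm \<zeta> \<le> 1 \<longrightarrow> b + t *\<^sub>R \<nu> + \<zeta> *s w + \<zeta>\<^sup>2 *s u \<in> \<Omega>) \<and>
        (\<forall>\<zeta>. norm \<zeta> = 1 \<longrightarrow> ball (b + t *\<^sub>R \<nu> + \<zeta> *s w + \<zeta>\<^sup>2 *s u) \<eta> \<subseteq> \<Omega>)"
    using pseudoconcave_disc_family [OF assms(1,4,5,6)] by metis
  define L where "L = real CARD('n) * (2 * M / \<eta> * norm \<nu>)"
  have "((\<lambda>s. L * s) \<longlongrightarrow> L * 0) (at_right 0)" "((\<lambda>s. norm (s *\<^sub>R \<nu>)) \<longlongrightarrow> norm (0 *\<^sub>R \<nu>)) (at_right 0)"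
    "((\<lambda>s. s) \<longlongrightarrow> 0) (at_right (0::real))"
    by (intro tendsto_intros)+
  then have "\<forall>\<^sub>F s in at_right 0. L * s < R \<and> norm (s *\<^sub>R \<nu>) < min \<eta> (\<delta> / 2) \<and> s < \<delta> \<and> 0 < s"
    using R(1) \<eta> \<delta> by (intro eventually_conj order_tendstoD(2)) (auto simp: eventually_at_right_less)
  \<comment> \<open>A length \<open>\<epsilon>\<close> of normal segments on which the Lipschitz estimate stays below \<open>R\<close>.\<close>
  then obtain \<epsilon> where \<epsilon>: "0 < \<epsilon>" "\<epsilon> < \<delta>" "L * \<epsilon> < R" "norm (\<epsilon> *\<^sub>R \<nu>) < min \<eta> (\<delta> / 2)"
    using eventually_happens' [OF trivial_limit_at_right_real] by blast
  have "isCont \<rho> (P - \<epsilon> *\<^sub>R \<nu>)"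
    using cont\<rho> [of UNIV] by (simp add: continuous_on_eq_continuous_at)
  then have "(\<lambda>j. \<rho> (\<phi> j X - \<epsilon> *\<^sub>R \<nu>)) \<longlonglongrightarrow> \<rho> (P - \<epsilon> *\<^sub>R \<nu>)"
    by (rule isCont_tendsto_compose) (intro tendsto_diff lim tendsto_const)
  then have "\<forall>\<^sub>F j in sequentially. 0 < \<rho> (\<phi> j X - \<epsilon> *\<^sub>R \<nu>)"
    using out [OF \<epsilon>(1,2)] by (rule order_tendstoD)
  moreover have "\<forall>\<^sub>F j in sequentially. dist (\<phi> j X) P < \<delta> / 2"
    using lim \<delta> by (intro tendstoD) auto
  ultimately obtain j where j: "0 < \<rho> (\<phi> j X - \<epsilon> *\<^sub>R \<nu>)" "dist (\<phi> j X) P < \<delta> / 2"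
    using eventually_happens [OF eventually_conj] by fastforce
  define q where "q = \<phi> j X"
  define \<psi> where "\<psi> = inv_into \<Omega> (\<phi> j)"
  have bij: "bij_betw (\<phi> j) \<Omega> \<Omega>" and hol: "holomorphic_map_on (\<phi> j) \<Omega>" "holomorphic_map_on \<psi> \<Omega>"
    using aut [of j] by (auto simp: automorphism_def \<psi>_def)
  have q\<Omega>: "q \<in> \<Omega>" using bij X by (auto simp: q_def bij_betw_def)
  have \<psi>\<Omega>: "\<psi> z \<in> \<Omega>" "\<phi> j (\<psi> z) = z" if "z \<in> \<Omega>" for z
    using bij that by (auto simp: \<psi>_def bij_betw_def inv_into_into f_inv_into_f)
  have \<psi>q: "\<psi> q = X" using bij X by (simp add: \<psi>_def q_def bij_betw_def)
  \<comment> \<open>Going down from \<open>q\<close> along the normal, \<open>\<rho>\<close> changes sign within \<open>\<epsilon>\<close>.\<close>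
  have "\<exists>s\<ge>0. s \<le> \<epsilon> \<and> \<rho> (q - s *\<^sub>R \<nu>) = 0"
    using q\<Omega> j(1) \<epsilon>(1) by (intro IVT') (auto simp: \<Omega> q_def intro!: continuous_on_compose2 [OF cont\<rho> [of UNIV]] continuous_intros)
  then obtain s where s: "0 \<le> s" "s \<le> \<epsilon>" "\<rho> (q - s *\<^sub>R \<nu>) = 0" by blast
  have "s \<noteq> 0" using s(3) q\<Omega> by (auto simp: \<Omega>)
  with s have "0 < s" by simp
  define b where "b = q - s *\<^sub>R \<nu>"
  have sb: "b + s *\<^sub>R \<nu> = q" by (simp add: b_def)
  have "norm (s *\<^sub>R \<nu>) \<le> norm (\<epsilon> *\<^sub>R \<nu>)" using s by (simp add: mult_right_mono)
  then have small: "norm (s *\<^sub>R \<nu>) < \<eta>" "norm (s *\<^sub>R \<nu>) < \<delta> / 2" using \<epsilon>(4) by auto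
  have "dist P b \<le> dist P q + norm (s *\<^sub>R \<nu>)"
    using dist_triangle [of P b q] by (simp add: b_def dist_norm)
  then have "b \<in> ball P \<delta>" using j(2) small(2) by (simp add: q_def dist_commute)
  from discs [OF this s(3)[folded b_def]] obtain w u where
    disc: "\<And>t \<zeta>. 0 < t \<Longrightarrow> t < \<delta> \<Longrightarrow> norm \<zeta> \<le> 1 \<Longrightarrow> b + t *\<^sub>R \<nu> + \<zeta> *s w + \<zeta>\<^sup>2 *s u \<in> \<Omega>"
    and edge: "\<And>t \<zeta>. 0 < t \<Longrightarrow> t < \<delta> \<Longrightarrow> norm \<zeta> = 1 \<Longrightarrow> ball (b + t *\<^sub>R \<nu> + \<zeta> *s w + \<zeta>\<^sup>2 *s u) \<eta> \<subseteq> \<Omega>"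
    by blast
  \<comment> \<open>The inverse \<open>\<psi>\<close> moves the segment from \<open>q\<close> down to \<open>b\<close> by less than \<open>R\<close> away from \<open>\<psi> q = X\<close>.\<close>
  have near: "b + t *\<^sub>R \<nu> \<in> \<phi> j ` cball X R" if t: "0 < t" "t \<le> s" for t
  proof -
    have b\<Omega>: "b + t *\<^sub>R \<nu> \<in> \<Omega>" using disc [of t 0] t s \<epsilon> by simp
    have dq: "dist q (b + t *\<^sub>R \<nu>) = (s - t) * norm \<nu>"
    proof -
      have "q - (b + t *\<^sub>R \<nu>) = (s - t) *\<^sub>R \<nu>" by (simp add: b_def algebra_simps)
      then show ?thesis using t by (simp add: dist_norm)
    qed
    have "norm (\<psi> (b + t *\<^sub>R \<nu>) - \<psi> q) \<le> real CARD('n) * (2 * M / \<eta> * dist q (b + t *\<^sub>R \<nu>))"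
    proof (rule holomorphic_map_Lipschitz_disc_centers [OF hol(2)])
      show "norm (\<psi> z) < M" if "z \<in> \<Omega>" for z using M \<psi>\<Omega> that by blast
      show "q + \<zeta> *s w + \<zeta>\<^sup>2 *s u \<in> \<Omega>" if "norm \<zeta> \<le> 1" for \<zeta>
        using disc [of s \<zeta>] that \<open>0 < s\<close> s \<epsilon> by (simp add: sb)
      show "b + t *\<^sub>R \<nu> + \<zeta> *s w + \<zeta>\<^sup>2 *s u \<in> \<Omega>" if "norm \<zeta> \<le> 1" for \<zeta>
        using disc [of t \<zeta>] that t s \<epsilon> by simp
      show "ball (q + \<zeta> *s w + \<zeta>\<^sup>2 *s u) \<eta> \<subseteq> \<Omega>" if "norm \<zeta> = 1" for \<zeta>
        using edge [of s \<zeta>] that \<open>0 < s\<close> s \<epsilon> by (simp add: sb)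
      have "(s - t) * norm \<nu> \<le> s * norm \<nu>" using t by (intro mult_right_mono) auto
      then show "dist q (b + t *\<^sub>R \<nu>) < \<eta>" using small(1) \<open>0 < s\<close> by (simp add: dq)
    qed
    also have "\<dots> = L * (s - t)" by (simp add: L_def dq)
    also have "\<dots> \<le> L * \<epsilon>"
    proof -
      have "M > 0" using M [OF X] norm_ge_zero [of X] by linarith
      then have "L \<ge> 0" using \<eta> by (simp add: L_def)
      then show ?thesis using t s by (intro mult_left_mono) auto
    qed
    also have "\<dots> < R" by fact
    finally have "\<psi> (b + t *\<^sub>R \<nu>) \<in> cball X R" by (simp add: \<psi>q dist_norm norm_minus_commute)
    with \<psi>\<Omega>(2) [OF b\<Omega>] show ?thesis by (metis imageI)
  qed
  have "continuous_on (cball X R) (\<phi> j)"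
    using hol(1) R(2) unfolding holomorphic_map_on_def
    by (meson continuous_at_imp_continuous_on has_derivative_continuous subsetD)
  then have "closed (\<phi> j ` cball X R)"
    by (intro compact_imp_closed compact_continuous_image) auto
  moreover have "((\<lambda>t. b + t *\<^sub>R \<nu>) \<longlongrightarrow> b + 0 *\<^sub>R \<nu>) (at_right 0)"
    by (intro tendsto_intros)
  moreover have "\<forall>\<^sub>F t in at_right 0. b + t *\<^sub>R \<nu> \<in> \<phi> j ` cball X R"
    using near \<open>0 < s\<close> by (auto simp: eventually_at_right_field intro!: exI [of _ s])
  ultimately have "b \<in> \<phi> j ` cball X R"
    using Lim_in_closed_set [of "\<phi> j ` cball X R" "\<lambda>t. b + t *\<^sub>R \<nu>" "at_right 0"] by simp
  then have "b \<in> \<Omega>" using bij R(2) by (auto simp: bij_betw_def)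
  then show False using s(3) by (simp add: \<Omega> b_def)
qed

end
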